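(* Let $\mathbf A=(a_{ij})$, $\mathbf b=(b_j)$ be the coefficients of an explicit Runge--Kutta scheme of order $p$ with $s$ stages. Consider the method $$\mathbf y^{(i)}=\mathbf y^n+\phi_i(\mathbf Y^n,h)\,h\sum_{j=1}^{i-1}a_{ij}\mathbf F(\mathbf y^{(j)}),\quad i=1,\dots,s,\qquad \mathbf y^{n+1}=\mathbf y^n+\phi_{n+1}(\mathbf Y^n,h)\,h\sum_{j=1}^s b_j\mathbf F(\mathbf y^{(j)})$$ with real-valued functions $\phi_i,\phi_{n+1}$, applied to $\mathbf y'(t)=\mathbf F(\mathbf y(t))$. Assume $\phi_i(\mathbf Y^n,h)=\mathcal O(1)$ as $h\to0$ for $i=2,\dots,s$ and that $\mathbf F\in\mathcal C^{p+1}(\mathbb R^d,\mathbb R^d)$ is Lipschitz continuous. Then: (a) if $p=1$, the method is of order $1$ if and only if $\phi_{n+1}(\mathbf Y^n,h)=1+\mathcal O(h)$; (b) if $p=s=2$, the method is of order $2$ if and only if $\phi_2(\mathbf Y^n,h)=1+\mathcal O(h)$ and $\phi_{n+1}(\mathbf Y^n,h)=1+\mathcal O(h^2)$.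
   Context: $\mathbf Y^n=(\mathbf y^n,\mathbf y^{(1)},\dots,\mathbf y^{(s)},\mathbf y^{n+1})$ collects the numerical quantities of the step, which satisfy the displayed equations; the value of $\phi_1$ is irrelevant. All $\mathcal O$-statements are with respect to $h\to0$. (Methods of this form include the Geometric Conservative (GeCo) schemes.) A method is of order $p$ (meaning at least $p$) if, whenever $\mathbf y^n=\mathbf y(t_n)$ for a solution $\mathbf y$, $\mathbf y^{n+1}=\mathbf y(t_n+h)+\mathcal O(h^{p+1})$. As usual in Runge--Kutta order theory, order statements refer to the whole class of right-hand sides with the stated regularity, the elementary differentials of $\mathbf F$ belonging to different rooted trees being regarded as linearly independent. *)

theory Defs
  imports "HOL-Analysis.Analysis" "HOL-Library.Landau_Symbols"
begin

text \<open>The class \<open>C\<^sup>k\<close> on a Euclidean space: all iterated directional derivatives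
  up to order \<open>k\<close> exist and are continuous.\<close>

primrec C_diff :: "nat \<Rightarrow> ('a::euclidean_space \<Rightarrow> 'b::euclidean_space) \<Rightarrow> bool" where
  "C_diff 0 f \<longleftrightarrow> continuous_on UNIV f"
| "C_diff (Suc k) f \<longleftrightarrow> (\<forall>x. f differentiable (at x)) \<and>
     (\<forall>v. C_diff k (\<lambda>x. frechet_derivative f (at x) v))"

text \<open>A set of initial value problems, as a predicate on the right-hand side and the initial
  value.\<close>

type_synonym 'a problem_class = "('a \<Rightarrow> 'a) \<Rightarrow> 'a \<Rightarrow> bool"

definition regular_problem :: "nat \<Rightarrow> 'a::euclidean_space problem_class" where
  "regular_problem p F y0 \<longleftrightarrow> C_diff (p + 1) F \<and> (\<exists>L. L-lipschitz_on UNIV F)"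

text \<open>The rooted trees with at most two vertices are the single vertex and the single edge.
  Their elementary differentials at \<open>y\<close> are \<open>F y\<close> and \<open>F' y (F y)\<close>. The list contains those
  belonging to trees with at most \<open>p\<close> vertices and is meant for \<open>p \<le> 2\<close> only.\<close>

definition elementary_differentials ::
    "nat \<Rightarrow> ('a::euclidean_space \<Rightarrow> 'a) \<Rightarrow> 'a \<Rightarrow> 'a list" where
  "elementary_differentials p F y = take p [F y, frechet_derivative F (at y) (F y)]"

text \<open>Linear independence is that of the family indexed by the trees, hence the distinctness.
  It has to hold at the initial value itself: if, for example, \<open>F y0 = 0\<close>, then the step never
  leaves \<open>y0\<close> and says nothing about the factors.\<close>

definition generic_problem :: "nat \<Rightarrow> 'a::euclidean_space problem_class" where
  "generic_problem p F y0 \<longleftrightarrow> regular_problem p F y0 \<and>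
     distinct (elementary_differentials p F y0) \<and>
     independent (set (elementary_differentials p F y0))"

definition solution_from :: "('a::euclidean_space \<Rightarrow> 'a) \<Rightarrow> real \<Rightarrow> (real \<Rightarrow> 'a) \<Rightarrow> bool" where
  "solution_from F t0 y \<longleftrightarrow> (\<exists>\<delta>>0. \<forall>t\<in>{t0..t0 + \<delta>}.
     (y has_vector_derivative F (y t)) (at t within {t0..t0 + \<delta>}))"

text \<open>The quantities of one step form a list \<open>Y\<close> of length \<open>s + 2\<close>: the initial value \<open>Y ! 0\<close>,
  the stages \<open>Y ! 1, \<dots>, Y ! s\<close> and the new value \<open>Y ! (s + 1)\<close>. A factor is a real-valued
  function of \<open>Y\<close> and \<open>h\<close>, which may moreover be built from the right-hand side, as in the
  Geometric Conservative schemes. As factors see all of \<open>Y\<close>, a step is in general given only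
  implicitly.\<close>

type_synonym 'a factor = "('a \<Rightarrow> 'a) \<Rightarrow> 'a list \<Rightarrow> real \<Rightarrow> real"

definition method_step ::
    "nat \<Rightarrow> (nat \<Rightarrow> nat \<Rightarrow> real) \<Rightarrow> (nat \<Rightarrow> real) \<Rightarrow> (nat \<Rightarrow> 'a factor) \<Rightarrow> 'a factor \<Rightarrow>
     ('a::euclidean_space \<Rightarrow> 'a) \<Rightarrow> 'a \<Rightarrow> real \<Rightarrow> 'a list \<Rightarrow> bool" where
  "method_step s A b \<phi> \<phi>new F y0 h Y \<longleftrightarrow>
     length Y = s + 2 \<and> Y ! 0 = y0 \<and>
     (\<forall>i\<in>{1..s}. Y ! i = y0 + (\<phi> i F Y h * h) *\<^sub>R (\<Sum>j = 1..<i. A i j *\<^sub>R F (Y ! j))) \<and>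
     Y ! (s + 1) = y0 + (\<phi>new F Y h * h) *\<^sub>R (\<Sum>j = 1..s. b j *\<^sub>R F (Y ! j))"

text \<open>\<open>Y h\<close> are the quantities of the step of size \<open>h\<close> from \<open>y0\<close>, for all small \<open>h > 0\<close>.
  The property \<open>Q\<close> is required of every problem in \<open>\<C>\<close> and every such \<open>Y\<close>.\<close>

definition for_all_steps ::
    "'a::euclidean_space problem_class \<Rightarrow>
     nat \<Rightarrow> (nat \<Rightarrow> nat \<Rightarrow> real) \<Rightarrow> (nat \<Rightarrow> real) \<Rightarrow> (nat \<Rightarrow> 'a factor) \<Rightarrow> 'a factor \<Rightarrow>
     (('a \<Rightarrow> 'a) \<Rightarrow> 'a \<Rightarrow> (real \<Rightarrow> 'a list) \<Rightarrow> bool) \<Rightarrow> bool" where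
  "for_all_steps \<C> s A b \<phi> \<phi>new Q \<longleftrightarrow>
     (\<forall>F y0 Y. \<C> F y0 \<longrightarrow>
        (\<forall>\<^sub>F h in at_right 0. method_step s A b \<phi> \<phi>new F y0 h (Y h)) \<longrightarrow> Q F y0 Y)"

definition method_order ::
    "'a::euclidean_space problem_class \<Rightarrow>
     nat \<Rightarrow> (nat \<Rightarrow> nat \<Rightarrow> real) \<Rightarrow> (nat \<Rightarrow> real) \<Rightarrow> (nat \<Rightarrow> 'a factor) \<Rightarrow> 'a factor \<Rightarrow>
     nat \<Rightarrow> bool" where
  "method_order \<C> s A b \<phi> \<phi>new p \<longleftrightarrow>
     for_all_steps \<C> s A b \<phi> \<phi>new (\<lambda>F y0 Y.
       \<forall>t0 y. solution_from F t0 y \<and> y t0 = y0 \<longrightarrow>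
         (\<lambda>h. norm (Y h ! (s + 1) - y (t0 + h))) \<in> O[at_right 0](\<lambda>h. h ^ (p + 1)))"

definition factor_one_plus_O ::
    "'a::euclidean_space problem_class \<Rightarrow>
     nat \<Rightarrow> (nat \<Rightarrow> nat \<Rightarrow> real) \<Rightarrow> (nat \<Rightarrow> real) \<Rightarrow> (nat \<Rightarrow> 'a factor) \<Rightarrow> 'a factor \<Rightarrow>
     'a factor \<Rightarrow> nat \<Rightarrow> bool" where
  "factor_one_plus_O \<C> s A b \<phi> \<phi>new \<psi> q \<longleftrightarrow>
     for_all_steps \<C> s A b \<phi> \<phi>new (\<lambda>F y0 Y.
       (\<lambda>h. \<psi> F (Y h) h - 1) \<in> O[at_right 0](\<lambda>h. h ^ q))"

text \<open>The underlying explicit Runge--Kutta scheme has all factors equal to \<open>1\<close>. Only the entries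
  of \<open>A\<close> below the diagonal enter. The order is that on the Euclidean space \<open>'a\<close>.\<close>

definition explicit_rk_order ::
    "'a::euclidean_space itself \<Rightarrow> nat \<Rightarrow> (nat \<Rightarrow> nat \<Rightarrow> real) \<Rightarrow> (nat \<Rightarrow> real) \<Rightarrow> nat \<Rightarrow> bool" where
  "explicit_rk_order _ s A b p \<longleftrightarrow>
     method_order (regular_problem p :: 'a problem_class) s A b (\<lambda>_ _ _ _. 1) (\<lambda>_ _ _. 1) p"

end

theory Submission
  imports Defs
begin

text \<open>Write \<open>v = F y0\<close> and \<open>w = F' y0 (F y0)\<close>. Bounded stage factors keep all stages within
  \<open>O(h)\<close> of \<open>y0\<close>, so the new value of the modified method is
  \<open>y0 + \<phi>new h (v + O(h))\<close> in general, and \<open>y0 + \<phi>new h (v + (\<phi>\<^sub>2 h / 2) w + O(h\<^sup>2))\<close> for two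
  stages of order 2. Comparing this with the expansion \<open>y0 + h v + (h\<^sup>2 / 2) w + O(h\<^sup>3)\<close> of the
  solution, the leading term first shows that \<open>\<phi>new = 1 + O(h)\<close>, in particular that \<open>\<phi>new\<close> is
  bounded, and independence of \<open>v\<close> and \<open>w\<close> then separates the two conditions. The conditions
  \<open>\<Sum>b = 1\<close> and \<open>b\<^sub>2 a\<^sub>2\<^sub>1 = 1/2\<close> on the underlying scheme come from a constant right-hand side
  and from the identity.\<close>

section \<open>Orders of vanishing at \<open>0+\<close>\<close>

text \<open>Landau symbols are available for field-valued functions only, hence this vector-valued
  variant.\<close>

definition Oh :: "nat \<Rightarrow> (real \<Rightarrow> 'a::real_normed_vector) \<Rightarrow> bool" where
  "Oh k f \<longleftrightarrow> (\<exists>C. \<forall>\<^sub>F h in at_right 0. norm (f h) \<le> C * h ^ k)"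

lemma eventually_at_right_0_pos: "\<forall>\<^sub>F h::real in at_right 0. 0 < h"
  by (simp add: eventually_at_right_less)

lemma bigo_iff_Oh: "f \<in> O[at_right 0](\<lambda>h. h ^ k) \<longleftrightarrow> Oh k f" for f :: "real \<Rightarrow> real"
proof
  assume "f \<in> O[at_right 0](\<lambda>h. h ^ k)"
  then obtain c where "\<forall>\<^sub>F h in at_right 0. norm (f h) \<le> c * norm (h ^ k)"
    by (auto simp: bigo_def)
  with eventually_at_right_0_pos have "\<forall>\<^sub>F h in at_right 0. norm (f h) \<le> c * h ^ k"
    by eventually_elim simp
  then show "Oh k f"
    unfolding Oh_def by blast
next
  assume "Oh k f"
  then obtain C where "\<forall>\<^sub>F h in at_right 0. norm (f h) \<le> C * h ^ k"
    by (auto simp: Oh_def)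
  with eventually_at_right_0_pos
  have "\<forall>\<^sub>F h in at_right 0. norm (f h) \<le> C * norm (h ^ k)"
    by eventually_elim simp
  then show "f \<in> O[at_right 0](\<lambda>h. h ^ k)"
    by (rule bigoI)
qed

lemma Oh_norm_iff: "Oh k (\<lambda>h. norm (f h)) \<longleftrightarrow> Oh k f"
  by (simp add: Oh_def)

text \<open>A positive constant keeps estimates monotone when they are multiplied together or when
  the exponent is lowered.\<close>

lemma Oh_obtain:
  assumes "Oh k f"
  obtains C where "C > 0" "\<forall>\<^sub>F h in at_right 0. norm (f h) \<le> C * h ^ k"
proof -
  obtain C where "\<forall>\<^sub>F h in at_right 0. norm (f h) \<le> C * h ^ k"
    using assms by (auto simp: Oh_def)
  with eventually_at_right_0_pos
  have "\<forall>\<^sub>F h in at_right 0. norm (f h) \<le> (\<bar>C\<bar> + 1) * h ^ k"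
  proof eventually_elim
    case (elim h)
    then have "C * h ^ k \<le> (\<bar>C\<bar> + 1) * h ^ k"
      by (intro mult_right_mono) auto
    with elim(2) show ?case by (rule order_trans)
  qed
  then show ?thesis by (rule that[rotated]) simp
qed

text \<open>The comparison is between norms only, so \<open>f\<close> and \<open>g\<close> may take
  values in different spaces. In this way real-valued bounds control vector-valued
  remainders.\<close>

lemma Oh_dominated:
  assumes "Oh k g" "\<forall>\<^sub>F h in at_right 0. norm (f h) \<le> c * norm (g h)"
  shows "Oh k f"
proof -
  obtain C where "\<forall>\<^sub>F h in at_right 0. norm (g h) \<le> C * h ^ k"
    using assms(1) by (auto simp: Oh_def)
  with assms(2) have "\<forall>\<^sub>F h in at_right 0. norm (f h) \<le> (\<bar>c\<bar> * C) * h ^ k"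
  proof eventually_elim
    case (elim h)
    have "norm (f h) \<le> \<bar>c\<bar> * norm (g h)"
      using elim(1) by (rule order_trans) (simp add: mult_right_mono)
    also have "\<dots> \<le> \<bar>c\<bar> * (C * h ^ k)"
      using elim(2) by (simp add: mult_left_mono)
    finally show ?case by (simp add: mult.assoc)
  qed
  then show ?thesis unfolding Oh_def by blast
qed

lemma Oh_cong:
  assumes "\<forall>\<^sub>F h in at_right 0. f h = g h"
  shows "Oh k f \<longleftrightarrow> Oh k g"
proof
  show "Oh k g" if "Oh k f"
    using that by (rule Oh_dominated[where c = 1]) (use assms in eventually_elim, simp)
  show "Oh k f" if "Oh k g"
    using that by (rule Oh_dominated[where c = 1]) (use assms in eventually_elim, simp)
qed

section \<open>Algebra of orders of vanishing\<close>

lemma Oh_add: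
  assumes "Oh k f" "Oh k g"
  shows "Oh k (\<lambda>h. f h + g h)"
proof -
  obtain C D where "\<forall>\<^sub>F h in at_right 0. norm (f h) \<le> C * h ^ k"
    "\<forall>\<^sub>F h in at_right 0. norm (g h) \<le> D * h ^ k"
    using assms by (auto simp: Oh_def)
  then have "\<forall>\<^sub>F h in at_right 0. norm (f h + g h) \<le> (C + D) * h ^ k"
    by eventually_elim (auto intro: norm_triangle_le simp: distrib_right)
  then show ?thesis unfolding Oh_def by blast
qed

lemma Oh_minus: "Oh k f \<Longrightarrow> Oh k (\<lambda>h. - f h)"
  by (simp add: Oh_def)

lemma Oh_diff:
  assumes "Oh k f" "Oh k g"
  shows "Oh k (\<lambda>h. f h - g h)"
  using Oh_add[OF assms(1) Oh_minus[OF assms(2)]] by simp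

lemma Oh_0: "Oh k (\<lambda>_. 0)"
  by (auto simp: Oh_def intro!: exI[of _ 0])

lemma Oh_sum: "(\<And>i. i \<in> I \<Longrightarrow> Oh k (f i)) \<Longrightarrow> Oh k (\<lambda>h. \<Sum>i\<in>I. f i h)"
  by (induction I rule: infinite_finite_induct) (auto intro: Oh_0 Oh_add)

lemma Oh_const: "Oh 0 (\<lambda>_. c)"
  by (auto simp: Oh_def intro!: exI[of _ "norm c"])

lemma Oh_power: "Oh k (\<lambda>h. h ^ k :: real)"
  unfolding Oh_def
  by (rule exI[of _ 1]) (use eventually_at_right_0_pos in eventually_elim, simp)

lemma Oh_ident: "Oh 1 (\<lambda>h. h :: real)"
  using Oh_power[of 1] by simp

lemma Oh_scaleR:
  assumes "Oh i c" "Oh j f"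
  shows "Oh (i + j) (\<lambda>h. c h *\<^sub>R f h)"
proof -
  obtain C where C: "C > 0" "\<forall>\<^sub>F h in at_right 0. norm (c h) \<le> C * h ^ i"
    using assms(1) by (rule Oh_obtain)
  obtain D where D: "\<forall>\<^sub>F h in at_right 0. norm (f h) \<le> D * h ^ j"
    using assms(2) by (rule Oh_obtain)
  from C(2) D eventually_at_right_0_pos
  have "\<forall>\<^sub>F h in at_right 0. norm (c h *\<^sub>R f h) \<le> (C * D) * h ^ (i + j)"
  proof eventually_elim
    case (elim h)
    have "norm (c h *\<^sub>R f h) \<le> (C * h ^ i) * (D * h ^ j)"
      using elim \<open>C > 0\<close> by (simp add: mult_mono)
    then show ?case by (simp add: power_add mult_ac)
  qed
  then show ?thesis unfolding Oh_def by blast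
qed

lemma Oh_mult: "Oh i c \<Longrightarrow> Oh j f \<Longrightarrow> Oh (i + j) (\<lambda>h. c h * f h)" for f :: "real \<Rightarrow> real"
  using Oh_scaleR[of i c j f] by simp

lemma Oh_scaleR_const: "Oh k f \<Longrightarrow> Oh k (\<lambda>h. c *\<^sub>R f h)"
  using Oh_scaleR[OF Oh_const, of k f c] by simp

lemma Oh_mono:
  assumes "Oh j f" "i \<le> j"
  shows "Oh i f"
proof -
  obtain C where *: "C > 0" "\<forall>\<^sub>F h in at_right 0. norm (f h) \<le> C * h ^ j"
    using assms(1) by (rule Oh_obtain)
  \<comment> \<open>Powers of \<open>h\<close> decrease with the exponent only for \<open>h\<close>
    below 1.\<close>
  have "\<forall>\<^sub>F h::real in at_right 0. h < 1"
    by (rule eventually_at_right_real[THEN eventually_mono, of 0 1]) auto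
  with *(2) eventually_at_right_0_pos
  have "\<forall>\<^sub>F h in at_right 0. norm (f h) \<le> C * h ^ i"
  proof eventually_elim
    case (elim h)
    then have "h ^ j \<le> h ^ i"
      using assms(2) by (intro power_decreasing) auto
    then have "C * h ^ j \<le> C * h ^ i"
      using \<open>C > 0\<close> by simp
    with elim show ?case by simp
  qed
  then show ?thesis unfolding Oh_def by blast
qed

lemma Oh_cancel:
  assumes "Oh (Suc k) (\<lambda>h. h *\<^sub>R f h)"
  shows "Oh k f"
proof -
  obtain C where "\<forall>\<^sub>F h in at_right 0. norm (h *\<^sub>R f h) \<le> C * h ^ Suc k"
    using assms by (auto simp: Oh_def)
  with eventually_at_right_0_pos have "\<forall>\<^sub>F h in at_right 0. norm (f h) \<le> C * h ^ k"
  proof eventually_elim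
    case (elim h)
    then have "h * norm (f h) \<le> h * (C * h ^ k)" by (simp add: mult_ac)
    with elim show ?case by simp
  qed
  then show ?thesis unfolding Oh_def by blast
qed

lemma Oh_bounded_linear:
  assumes "bounded_linear T" "Oh k f"
  shows "Oh k (\<lambda>h. T (f h))"
proof -
  obtain K where "\<And>x. norm (T x) \<le> K * norm x"
    using bounded_linear.bounded[OF assms(1)] by (auto simp: mult.commute)
  then show ?thesis
    by (intro Oh_dominated[OF assms(2)] always_eventually) auto
qed

lemma Oh_lipschitz:
  assumes "L-lipschitz_on UNIV F" "Oh k (\<lambda>h. x h - y)"
  shows "Oh k (\<lambda>h. F (x h) - F y)"
  by (rule Oh_dominated[OF assms(2), where c = L])
    (use lipschitz_onD[OF assms(1)] in \<open>auto simp: dist_norm\<close>)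

section \<open>Limits and integration\<close>

lemma Oh_tendsto_0:
  assumes "Oh (Suc k) f"
  shows "(f \<longlongrightarrow> 0) (at_right 0)"
proof -
  obtain C where "\<forall>\<^sub>F h in at_right 0. norm (f h) \<le> C * h ^ Suc k"
    using assms by (auto simp: Oh_def)
  moreover have "((\<lambda>h::real. C * h ^ Suc k) \<longlongrightarrow> C * 0 ^ Suc k) (at_right 0)"
    by (intro tendsto_intros)
  ultimately show ?thesis
    by (intro Lim_null_comparison[of f "\<lambda>h. C * h ^ Suc k"]) simp_all
qed

text \<open>A constant that tends to 0 is 0. This is how algebraic order conditions are read off
  from asymptotic estimates.\<close>

lemma Oh_const_imp_0:
  assumes "Oh (Suc k) (\<lambda>_. c)"
  shows "c = 0"
  using tendsto_unique[OF _ tendsto_const Oh_tendsto_0[OF assms]] by simp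

text \<open>By the mean value inequality \<open>norm (u h)\<close> is at most
  \<open>h * norm (u' t)\<close> for some \<open>t\<close> strictly between 0 and \<open>h\<close>,
  and \<open>t ^ k\<close> is at most \<open>h ^ k\<close>.\<close>

lemma Oh_integrate:
  fixes u :: "real \<Rightarrow> 'a::euclidean_space"
  assumes "\<delta> > 0" "u 0 = 0"
    and der: "\<And>t. t \<in> {0..\<delta>} \<Longrightarrow> (u has_vector_derivative u' t) (at t within {0..\<delta>})"
    and "Oh k u'"
  shows "Oh (Suc k) u"
proof -
  obtain C where C: "C > 0" "\<forall>\<^sub>F h in at_right 0. norm (u' h) \<le> C * h ^ k"
    using \<open>Oh k u'\<close> by (rule Oh_obtain)
  then obtain e where e: "e > 0" "\<And>h. 0 < h \<Longrightarrow> h < e \<Longrightarrow> norm (u' h) \<le> C * h ^ k"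
    by (auto simp: eventually_at_right_field)
  \<comment> \<open>Below \<open>e\<close> the bound on \<open>u'\<close> holds at the intermediate
    point; below \<open>\<delta>\<close> that point is interior to the interval of
    differentiability.\<close>
  have bound: "norm (u h) \<le> C * h ^ Suc k" if h: "0 < h" "h < min e \<delta>" for h
  proof -
    have "continuous_on {0..\<delta>} u"
      by (rule continuous_on_vector_derivative) (rule der)
    then have "continuous_on {0..h} u"
      by (rule continuous_on_subset) (use h in auto)
    moreover have "(u has_derivative (\<lambda>x. x *\<^sub>R u' t)) (at t)" if "0 < t" "t < h" for t
    proof -
      \<comment> \<open>The mean value inequality asks for two-sided derivatives, which the one
        within an open interval is.\<close>
      have "(u has_vector_derivative u' t) (at t within {0<..<\<delta>})"
        by (rule has_vector_derivative_within_subset[OF der]) (use that h in auto)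
      then show ?thesis
        using that h by (simp add: has_vector_derivative_def at_within_open[of t "{0<..<\<delta>}"])
    qed
    ultimately obtain t where t: "0 < t" "t < h" "norm (u h - u 0) \<le> norm ((h - 0) *\<^sub>R u' t)"
      using mvt_general[of 0 h u "\<lambda>t x. x *\<^sub>R u' t"] h by auto
    then have "norm (u h) \<le> h * norm (u' t)"
      using \<open>u 0 = 0\<close> h by simp
    also have "\<dots> \<le> h * (C * t ^ k)"
      using e(2)[of t] t h by (intro mult_left_mono) auto
    also have "\<dots> \<le> h * (C * h ^ k)"
      using t h \<open>C > 0\<close> by (intro mult_left_mono power_mono) auto
    finally show ?thesis by (simp add: mult_ac)
  qed
  have "\<forall>\<^sub>F h in at_right 0. 0 < h \<and> h < min e \<delta>"
    using eventually_at_right_real[of 0 "min e \<delta>"] e(1) \<open>\<delta> > 0\<close> by simp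
  then have "\<forall>\<^sub>F h in at_right 0. norm (u h) \<le> C * h ^ Suc k"
    by eventually_elim (use bound in auto)
  then show ?thesis unfolding Oh_def by blast
qed

section \<open>Quadratic Taylor remainder\<close>

lemma C_diff_differentiable: "C_diff (Suc k) F \<Longrightarrow> F differentiable (at x)"
  by simp

lemma frechet_derivative_bounded_linear:
  "C_diff (Suc k) F \<Longrightarrow> bounded_linear (frechet_derivative F (at x))"
  by (rule has_derivative_bounded_linear)
    (rule frechet_derivative_works[THEN iffD1, OF C_diff_differentiable])

lemma C_diff_const: "C_diff k (\<lambda>_. c)"
  by (induction k arbitrary: c) auto

lemma C_diff_ident: "C_diff k (\<lambda>x. x)"
  by (cases k) (auto simp: C_diff_const)

text \<open>The increment is a bounded linear term plus an error, and the definition of the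
  derivative with tolerance 1 bounds that error by \<open>norm (x - y)\<close>.\<close>

lemma differentiable_imp_locally_Lipschitz_at:
  assumes "g differentiable (at y)"
  shows "\<exists>K. \<forall>\<^sub>F x in nhds y. norm (g x - g y) \<le> K * norm (x - y)"
proof -
  obtain g' where g': "(g has_derivative g') (at y)"
    using assms by (auto simp: differentiable_def)
  obtain K where K: "\<And>v. norm (g' v) \<le> norm v * K"
    using bounded_linear.bounded[OF has_derivative_bounded_linear[OF g']] by blast
  obtain d where d: "d > 0"
    "\<And>x. norm (x - y) < d \<Longrightarrow> norm (g x - g y - g' (x - y)) \<le> 1 * norm (x - y)"
    using g' unfolding has_derivative_at_alt by (meson zero_less_one)
  have "norm (g x - g y) \<le> (1 + K) * norm (x - y)" if "dist x y < d" for x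
    using d(2)[of x] K[of "x - y"] that norm_triangle_ineq[of "g x - g y - g' (x - y)" "g' (x - y)"]
    by (simp add: dist_norm algebra_simps)
  then show ?thesis
    using d(1) by (auto simp: eventually_nhds_metric)
qed

text \<open>Each partial derivative of \<open>F\<close> is itself differentiable at
  \<open>y\<close>, hence Lipschitz against \<open>y\<close>. Expanding the argument in the finite
  basis turns these bounds into one for the operator norm.\<close>

lemma C_diff_2_derivative_Lipschitz:
  fixes F :: "'a::euclidean_space \<Rightarrow> 'b::euclidean_space"
  assumes "C_diff (Suc (Suc k)) F"
  obtains K where "K \<ge> 0" "\<forall>\<^sub>F x in nhds y.
    onorm (frechet_derivative F (at x) - frechet_derivative F (at y)) \<le> K * norm (x - y)"
proof -
  let ?D = "\<lambda>x. frechet_derivative F (at x)"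
  have "\<forall>b. \<exists>K. \<forall>\<^sub>F x in nhds y. norm (?D x b - ?D y b) \<le> K * norm (x - y)"
    using assms by (intro allI differentiable_imp_locally_Lipschitz_at) simp
  then obtain K where K: "\<And>b. \<forall>\<^sub>F x in nhds y. norm (?D x b - ?D y b) \<le> K b * norm (x - y)"
    by metis
  \<comment> \<open>The constants \<open>K b\<close> come without a sign, hence the absolute values;
    each coordinate \<open>v \<bullet> b\<close> is at most \<open>norm v\<close>.\<close>
  define M where "M = (\<Sum>b\<in>Basis. \<bar>K b\<bar>)"
  have "\<forall>\<^sub>F x in nhds y. \<forall>b\<in>Basis. norm (?D x b - ?D y b) \<le> K b * norm (x - y)"
    using K by (intro eventually_ball_finite) auto
  then have "\<forall>\<^sub>F x in nhds y. onorm (?D x - ?D y) \<le> M * norm (x - y)"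
  proof eventually_elim
    case (elim x)
    have bl: "bounded_linear (?D x - ?D y)"
      unfolding fun_diff_def
      using assms by (intro bounded_linear_sub frechet_derivative_bounded_linear)
    show ?case
    proof (rule onorm_le)
      fix v
      have "(?D x - ?D y) v = (?D x - ?D y) (\<Sum>b\<in>Basis. (v \<bullet> b) *\<^sub>R b)"
        by (simp only: euclidean_representation)
      also have "\<dots> = (\<Sum>b\<in>Basis. (v \<bullet> b) *\<^sub>R (?D x - ?D y) b)"
        by (simp only: linear_sum[OF bounded_linear.linear[OF bl]]
          linear_scale[OF bounded_linear.linear[OF bl]])
      also have "norm \<dots> \<le> (\<Sum>b\<in>Basis. norm v * (\<bar>K b\<bar> * norm (x - y)))"
      proof (rule sum_norm_le)
        fix b :: 'a assume b: "b \<in> Basis"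
        have "norm ((?D x - ?D y) b) \<le> \<bar>K b\<bar> * norm (x - y)"
          using elim b
          by (auto intro!: order_trans[OF bspec[OF elim b]] mult_right_mono)
        then show "norm ((v \<bullet> b) *\<^sub>R (?D x - ?D y) b) \<le> norm v * (\<bar>K b\<bar> * norm (x - y))"
          using Basis_le_norm[OF b, of v] by (simp add: mult_mono)
      qed
      also have "\<dots> = M * norm (x - y) * norm v"
        by (simp add: M_def sum_distrib_left sum_distrib_right mult_ac)
      finally show "norm ((?D x - ?D y) v) \<le> M * norm (x - y) * norm v" .
    qed
  qed
  moreover have "M \<ge> 0"
    by (simp add: M_def sum_nonneg)
  ultimately show ?thesis
    using that by blast
qed

text \<open>Mean value inequality for \<open>F\<close> minus its linearization at \<open>y\<close>:
  between \<open>y\<close> and \<open>x\<close> the derivative deviates from the one at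
  \<open>y\<close> by at most \<open>K * norm (x - y)\<close>, which supplies the second
  factor.\<close>

lemma C_diff_2_quadratic_remainder:
  fixes F :: "'a::euclidean_space \<Rightarrow> 'b::euclidean_space"
  assumes "C_diff (Suc (Suc k)) F"
  obtains K where "\<forall>\<^sub>F x in nhds y.
    norm (F x - F y - frechet_derivative F (at y) (x - y)) \<le> K * (norm (x - y))\<^sup>2"
proof -
  let ?D = "\<lambda>x. frechet_derivative F (at x)"
  obtain K where K: "K \<ge> 0" "\<forall>\<^sub>F x in nhds y. onorm (?D x - ?D y) \<le> K * norm (x - y)"
    using assms by (rule C_diff_2_derivative_Lipschitz)
  then obtain d where d: "d > 0" "\<And>x. dist x y < d \<Longrightarrow> onorm (?D x - ?D y) \<le> K * norm (x - y)"
    by (auto simp: eventually_nhds_metric)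
  have "norm (F x - F y - ?D y (x - y)) \<le> K * (norm (x - y))\<^sup>2" if x: "dist x y < d" for x
  proof -
    have "norm (F x - F y - ?D y (x - y)) \<le> norm (x - y) * (K * norm (x - y))"
    \<comment> \<open>This ball contains the segment from \<open>y\<close> to \<open>x\<close>, and
      none of its points is farther from \<open>y\<close> than \<open>x\<close> is, so one bound
      serves for all of them.\<close>
    proof (rule differentiable_bound_linearization[where S = "cball y (norm (x - y))"])
      fix t :: real assume "t \<in> {0..1}"
      then show "y + t *\<^sub>R (x - y) \<in> cball y (norm (x - y))"
        by (simp add: dist_norm mult_left_le_one_le)
    next
      fix z assume z: "z \<in> cball y (norm (x - y))"
      show "(F has_derivative ?D z) (at z within cball y (norm (x - y)))"
        by (rule has_derivative_at_withinI)
          (rule frechet_derivative_works[THEN iffD1, OF C_diff_differentiable[OF assms]])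
      have "onorm (?D z - ?D y) \<le> K * norm (z - y)"
        using z x by (intro d(2)) (auto simp: dist_norm norm_minus_commute)
      also have "\<dots> \<le> K * norm (x - y)"
        using z K(1) by (intro mult_left_mono) (auto simp: dist_norm norm_minus_commute)
      finally show "onorm (?D z - ?D y) \<le> K * norm (x - y)" .
    qed simp
    then show ?thesis by (simp add: power2_eq_square mult_ac)
  qed
  then have "\<forall>\<^sub>F x in nhds y. norm (F x - F y - ?D y (x - y)) \<le> K * (norm (x - y))\<^sup>2"
    using d(1) by (auto simp: eventually_nhds_metric)
  then show ?thesis by (rule that)
qed

text \<open>As \<open>x h\<close> tends to \<open>y\<close>, it eventually enters the neighbourhood
  of the Taylor estimate, and the square of an O(h) displacement is O(h^2).\<close>

lemma Oh_quadratic_remainder: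
  fixes F :: "'a::euclidean_space \<Rightarrow> 'b::euclidean_space"
  assumes "C_diff (Suc (Suc k)) F" and x: "Oh 1 (\<lambda>h. x h - y)"
  shows "Oh 2 (\<lambda>h. F (x h) - F y - frechet_derivative F (at y) (x h - y))"
proof -
  obtain K where K: "\<forall>\<^sub>F x in nhds y.
      norm (F x - F y - frechet_derivative F (at y) (x - y)) \<le> K * (norm (x - y))\<^sup>2"
    using assms(1) by (rule C_diff_2_quadratic_remainder)
  have "((\<lambda>h. x h - y) \<longlongrightarrow> 0) (at_right 0)"
    using x Oh_tendsto_0[of 0 "\<lambda>h. x h - y"] by simp
  then have "(x \<longlongrightarrow> y) (at_right 0)"
    by (simp add: LIM_zero_iff)
  from filterlim_iff[THEN iffD1, OF this, rule_format, OF K]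
  have "\<forall>\<^sub>F h in at_right 0. norm (F (x h) - F y - frechet_derivative F (at y) (x h - y))
      \<le> K * norm (norm (x h - y) * norm (x h - y))"
    by (simp add: power2_eq_square)
  moreover have "Oh (1 + 1) (\<lambda>h. norm (x h - y) * norm (x h - y))"
    using x by (intro Oh_mult) (simp_all only: Oh_norm_iff)
  ultimately show ?thesis
    unfolding one_add_one by (rule Oh_dominated[rotated])
qed

section \<open>Solutions of the initial value problem\<close>

text \<open>The equation is autonomous, so time can be shifted to start at 0, where
  \<open>Oh\<close> measures.\<close>

lemma solution_from_shifted:
  assumes "solution_from F t0 y"
  obtains \<delta> where "\<delta> > 0" "\<And>t. t \<in> {0..\<delta>} \<Longrightarrow>
    ((\<lambda>h. y (t0 + h)) has_vector_derivative F (y (t0 + t))) (at t within {0..\<delta>})"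
proof -
  obtain \<delta> where \<delta>: "\<delta> > 0" "\<And>t. t \<in> {t0..t0 + \<delta>} \<Longrightarrow>
      (y has_vector_derivative F (y t)) (at t within {t0..t0 + \<delta>})"
    using assms by (auto simp: solution_from_def)
  have "((\<lambda>h. y (t0 + h)) has_vector_derivative F (y (t0 + t))) (at t within {0..\<delta>})"
    if "t \<in> {0..\<delta>}" for t
  proof -
    have "((+) t0 has_vector_derivative 1) (at t within {0..\<delta>})"
      by (auto intro!: derivative_eq_intros)
    moreover have "(y has_vector_derivative F (y (t0 + t))) (at (t0 + t) within (+) t0 ` {0..\<delta>})"
      using \<delta>(2)[of "t0 + t"] that by (simp add: add.commute)
    ultimately show ?thesis
      using vector_diff_chain_within by (fastforce simp: o_def)
  qed
  with \<delta>(1) show ?thesis by (rule that)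
qed

text \<open>A bootstrap: continuity makes \<open>F\<close> along the solution bounded, integration
  gives an O(h) displacement, the Lipschitz property carries this over to \<open>F\<close>, and a
  second integration gives O(h^2).\<close>

lemma solution_expansion_1:
  fixes F :: "'a::euclidean_space \<Rightarrow> 'a"
  assumes L: "L-lipschitz_on UNIV F" and "solution_from F t0 y"
  shows "Oh 1 (\<lambda>h. y (t0 + h) - y t0)"
    and "Oh 2 (\<lambda>h. y (t0 + h) - y t0 - h *\<^sub>R F (y t0))"
proof -
  define z where "z h = y (t0 + h)" for h
  obtain \<delta> where \<delta>: "\<delta> > 0" and z: "\<And>t. t \<in> {0..\<delta>} \<Longrightarrow>
      (z has_vector_derivative F (z t)) (at t within {0..\<delta>})"
    unfolding z_def using solution_from_shifted[OF assms(2)] by blast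
  have "(z \<longlongrightarrow> z 0) (at_right 0)"
    using has_vector_derivative_continuous[OF z, of 0] \<delta>
    by (simp add: continuous_within at_within_Icc_at_right)
  then have "\<forall>\<^sub>F h in at_right 0. norm (z h - z 0) \<le> 1 * norm (1::real)"
    using tendstoD[of z "z 0" "at_right 0" 1] by (auto simp: dist_norm elim: eventually_mono)
  then have "Oh 0 (\<lambda>h. z h - z 0)"
    by (rule Oh_dominated[OF Oh_const])
  then have "Oh 0 (\<lambda>h. F (z h) - F (z 0) + F (z 0))"
    by (intro Oh_add Oh_lipschitz[OF L] Oh_const)
  then have "Oh (Suc 0) (\<lambda>h. z h - z 0)"
    by (intro Oh_integrate[where \<delta> = \<delta> and u' = "\<lambda>h. F (z h)"])
      (auto intro!: derivative_eq_intros z \<delta>)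
  then have *: "Oh 1 (\<lambda>h. z h - z 0)"
    by simp
  then show "Oh 1 (\<lambda>h. y (t0 + h) - y t0)"
    by (simp add: z_def)
  have "Oh (Suc 1) (\<lambda>h. z h - z 0 - h *\<^sub>R F (z 0))"
    by (rule Oh_integrate[where \<delta> = \<delta> and u' = "\<lambda>h. F (z h) - F (z 0)"])
      (use Oh_lipschitz[OF L *] in \<open>auto intro!: derivative_eq_intros z \<delta>\<close>)
  then show "Oh 2 (\<lambda>h. y (t0 + h) - y t0 - h *\<^sub>R F (y t0))"
    by (simp add: z_def numeral_2_eq_2)
qed

text \<open>One more round of the bootstrap. The derivative of the claimed remainder is
  \<open>F (z h) - F (z 0) - h *\<^sub>R D (F (z 0))\<close>, so it suffices that this is
  O(h^2).\<close>

lemma solution_expansion_2: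
  fixes F :: "'a::euclidean_space \<Rightarrow> 'a"
  assumes L: "L-lipschitz_on UNIV F" and C: "C_diff (Suc (Suc k)) F"
    and y: "solution_from F t0 y"
  shows "Oh 3 (\<lambda>h. y (t0 + h) - y t0 - h *\<^sub>R F (y t0)
    - (h\<^sup>2 / 2) *\<^sub>R frechet_derivative F (at (y t0)) (F (y t0)))"
proof -
  define D where "D = frechet_derivative F (at (y t0))"
  have D: "bounded_linear D"
    unfolding D_def using C by (rule frechet_derivative_bounded_linear)
  define z where "z h = y (t0 + h)" for h
  have z0: "z 0 = y t0"
    by (simp add: z_def)
  obtain \<delta> where \<delta>: "\<delta> > 0" and z: "\<And>t. t \<in> {0..\<delta>} \<Longrightarrow>
      (z has_vector_derivative F (z t)) (at t within {0..\<delta>})"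
    unfolding z_def using solution_from_shifted[OF y] by blast
  note e1 = solution_expansion_1[OF L y, folded z_def z0]
  \<comment> \<open>The first summand is the Taylor remainder of \<open>F\<close>; the second is
    \<open>D\<close> applied to the remainder of the first-order expansion.\<close>
  have "Oh 2 (\<lambda>h. (F (z h) - F (z 0) - D (z h - z 0)) + D (z h - z 0 - h *\<^sub>R F (z 0)))"
    unfolding D_def z0[symmetric]
    by (intro Oh_add Oh_quadratic_remainder[OF C] e1 Oh_bounded_linear[OF _ e1(2)]
        frechet_derivative_bounded_linear[OF C])
  also have "(\<lambda>h. (F (z h) - F (z 0) - D (z h - z 0)) + D (z h - z 0 - h *\<^sub>R F (z 0)))
      = (\<lambda>h. F (z h) - F (z 0) - h *\<^sub>R D (F (z 0)))"
    by (simp add: linear_diff[OF bounded_linear.linear[OF D]]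
        linear_scale[OF bounded_linear.linear[OF D]])
  finally have "Oh (Suc 2) (\<lambda>h. z h - z 0 - h *\<^sub>R F (z 0) - (h\<^sup>2 / 2) *\<^sub>R D (F (z 0)))"
    by (rule Oh_integrate[rotated 3, where \<delta> = \<delta>])
      (auto intro!: derivative_eq_intros z \<delta> simp: scaleR_left.diff)
  then show ?thesis
    by (simp add: z_def D_def eval_nat_numeral)
qed

text \<open>Picard--Lindeloef: the integral operator is a contraction of the bounded continuous
  functions once the interval is shorter than the inverse Lipschitz constant.\<close>

lemma lipschitz_solution_exists:
  fixes F :: "'a::euclidean_space \<Rightarrow> 'a"
  assumes L: "L-lipschitz_on UNIV F"
  obtains y where "solution_from F 0 y" "y 0 = y0"
proof -
  have "L \<ge> 0"
    using L by (rule lipschitz_on_nonneg)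
  \<comment> \<open>Chosen for contraction factor 1/2; adding 1 avoids a division by zero for
    \<open>L = 0\<close>.\<close>
  define \<delta> where "\<delta> = 1 / (2 * (L + 1))"
  have \<delta>: "\<delta> > 0" "L * \<delta> \<le> 1 / 2"
    using \<open>L \<ge> 0\<close> by (auto simp: \<delta>_def field_simps)
  have cont: "continuous_on {0..\<delta>} (\<lambda>s. F (apply_bcontfun f s))" for f :: "real \<Rightarrow>\<^sub>C 'a"
    by (rule continuous_on_compose2[OF lipschitz_on_continuous_on[OF L]]) auto
  define G where "G f t = y0 + integral {0..t} (\<lambda>s. F (apply_bcontfun f s))"
    for f :: "real \<Rightarrow>\<^sub>C 'a" and t
  \<comment> \<open>The complete space consists of functions on the whole line, so the integral is
    extended by its boundary values outside \<open>{0..\<delta>}\<close>.\<close>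
  have "\<exists>g :: real \<Rightarrow>\<^sub>C 'a. \<forall>t. apply_bcontfun g t = G f (clamp 0 \<delta> t)" for f
  proof -
    have "continuous_on (cbox 0 \<delta>) (G f)"
      unfolding G_def cbox_interval
      by (intro continuous_intros indefinite_integral_continuous_1 integrable_continuous_real cont)
    then show ?thesis
      using continuous_on_cbox_bcontfunE by metis
  qed
  then obtain T :: "(real \<Rightarrow>\<^sub>C 'a) \<Rightarrow> real \<Rightarrow>\<^sub>C 'a"
    where T: "\<And>f t. apply_bcontfun (T f) t = G f (clamp 0 \<delta> t)"
    by metis
  have "dist (T f) (T g) \<le> 1 / 2 * dist f g" for f g
  proof (rule dist_bound)
    fix x
    define t where "t = clamp 0 \<delta> x"
    have t: "t \<in> {0..\<delta>}"
      unfolding t_def using clamp_in_interval[of 0 \<delta> x] \<delta>(1) by (simp add: cbox_interval)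
    have int: "(\<lambda>s. F (apply_bcontfun u s)) integrable_on {0..t}" for u
      by (rule integrable_continuous_real, rule continuous_on_subset[OF cont]) (use t in auto)
    have "dist (apply_bcontfun (T f) x) (apply_bcontfun (T g) x)
        = norm (integral {0..t} (\<lambda>s. F (apply_bcontfun f s) - F (apply_bcontfun g s)))"
      by (simp add: T G_def dist_norm integral_diff[OF int int] flip: t_def)
    also have "\<dots> \<le> (L * dist f g) * (t - 0)"
    proof (rule integral_bound)
      show "continuous_on {0..t} (\<lambda>s. F (apply_bcontfun f s) - F (apply_bcontfun g s))"
        by (intro continuous_on_diff continuous_on_subset[OF cont]) (use t in auto)
      show "norm (F (apply_bcontfun f s) - F (apply_bcontfun g s)) \<le> L * dist f g" for s
        using lipschitz_onD[OF L, of "apply_bcontfun f s" "apply_bcontfun g s"]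
          mult_left_mono[OF dist_bounded[of f s g] \<open>L \<ge> 0\<close>]
        by (simp add: dist_norm)
    qed (use t in auto)
    also have "\<dots> \<le> (L * dist f g) * \<delta>"
      using t \<open>L \<ge> 0\<close> by (intro mult_left_mono) auto
    also have "\<dots> \<le> 1 / 2 * dist f g"
      using mult_right_mono[OF \<delta>(2), of "dist f g"] by (simp add: mult_ac)
    finally show "dist (apply_bcontfun (T f) x) (apply_bcontfun (T g) x) \<le> 1 / 2 * dist f g" .
  qed
  then obtain f where f: "T f = f"
    using banach_fix_type[of "1 / 2" T] by auto
  \<comment> \<open>Clamping is the identity on the interval, so there the fixed point solves the
    integral equation.\<close>
  have fG: "apply_bcontfun f t = G f t" if "t \<in> {0..\<delta>}" for t
    using T[of f t] that by (simp add: f clamp_cancel_cbox cbox_interval)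
  have "(apply_bcontfun f has_vector_derivative F (apply_bcontfun f t)) (at t within {0..\<delta>})"
    if t: "t \<in> {0..\<delta>}" for t
  proof -
    have "(G f has_vector_derivative F (apply_bcontfun f t)) (at t within {0..\<delta>})"
      unfolding G_def using integral_has_vector_derivative[OF cont t]
      by (auto intro!: derivative_eq_intros)
    then show ?thesis
      by (rule has_vector_derivative_transform[OF t, rotated]) (rule fG)
  qed
  then have "solution_from F 0 (apply_bcontfun f)"
    using \<delta>(1) by (auto simp: solution_from_def)
  moreover have "apply_bcontfun f 0 = y0"
    using fG[of 0] \<delta>(1) by (simp add: G_def)
  ultimately show ?thesis by (rule that)
qed

section \<open>Linear independence and factors\<close>

text \<open>Independence provides linear functionals with values (1, 0) and (0, 1) on
  \<open>v\<close> and \<open>w\<close>. They are bounded in finite dimension and extract the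
  coefficients.\<close>

lemma Oh_independent_coefficients:
  fixes v w :: "'a::euclidean_space"
  assumes "v \<noteq> w" "independent {v, w}" and vw: "Oh k (\<lambda>h. \<alpha> h *\<^sub>R v + \<beta> h *\<^sub>R w)"
  shows "Oh k \<alpha>" "Oh k \<beta>"
proof -
  have coeff: "\<exists>T::'a \<Rightarrow> real. bounded_linear T \<and> T v = a \<and> T w = c" for a c
  proof -
    obtain T :: "'a \<Rightarrow> real" where "linear T" "\<forall>x\<in>{v, w}. T x = (if x = v then a else c)"
      using linear_independent_extend[OF assms(2), of "\<lambda>x. if x = v then a else c"] by blast
    then show ?thesis
      using assms(1) by (auto simp: linear_linear)
  qed
  have ext: "(\<lambda>h. T (\<alpha> h *\<^sub>R v + \<beta> h *\<^sub>R w)) = (\<lambda>h. \<alpha> h * T v + \<beta> h * T w)"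
    if "bounded_linear T" for T :: "'a \<Rightarrow> real"
    using bounded_linear.linear[OF that] by (simp add: linear_add linear_scale)
  from coeff[of 1 0] obtain T :: "'a \<Rightarrow> real" where "bounded_linear T" "T v = 1" "T w = 0"
    by blast
  then show "Oh k \<alpha>"
    using Oh_bounded_linear[OF _ vw, of T] by (simp add: ext)
  from coeff[of 0 1] obtain T :: "'a \<Rightarrow> real" where "bounded_linear T" "T v = 0" "T w = 1"
    by blast
  then show "Oh k \<beta>"
    using Oh_bounded_linear[OF _ vw, of T] by (simp add: ext)
qed

text \<open>Subtracting \<open>e h\<close> leaves \<open>(g h - 1) *\<^sub>R (v + e h)\<close>, and
  \<open>v + e h\<close> eventually has norm at least \<open>norm v / 2\<close>, so it can be
  divided out. Boundedness of \<open>g\<close> is thus a consequence.\<close>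

lemma factor_from_leading_term:
  fixes v :: "'a::euclidean_space"
  assumes "v \<noteq> 0" and e: "Oh 1 e" and g: "Oh 1 (\<lambda>h. g h *\<^sub>R (v + e h) - v)"
  shows "Oh 1 (\<lambda>h. g h - 1)"
proof -
  have "(e \<longlongrightarrow> 0) (at_right 0)"
    using e Oh_tendsto_0[of 0 e] by simp
  then have "\<forall>\<^sub>F h in at_right 0. norm (e h) < norm v / 2"
    using tendstoD[of e 0 "at_right 0" "norm v / 2"] \<open>v \<noteq> 0\<close> by simp
  then have "\<forall>\<^sub>F h in at_right 0.
      norm (g h - 1) \<le> 2 / norm v * norm (g h *\<^sub>R (v + e h) - v - e h)"
  proof eventually_elim
    case (elim h)
    have "norm v / 2 \<le> norm (v + e h)"
      using elim norm_triangle_ineq4[of "v + e h" "e h"] by simp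
    then have "\<bar>g h - 1\<bar> * (norm v / 2) \<le> \<bar>g h - 1\<bar> * norm (v + e h)"
      by (rule mult_left_mono) simp
    also have "\<dots> = norm (g h *\<^sub>R (v + e h) - v - e h)"
      by (simp flip: norm_scaleR add: algebra_simps)
    finally show ?case
      using \<open>v \<noteq> 0\<close> by (simp add: field_simps)
  qed
  then show ?thesis
    by (rule Oh_dominated[OF Oh_diff[OF g e]])
qed

lemma factor_bounded: "Oh k (\<lambda>h. g h - 1) \<Longrightarrow> Oh 0 g" for g :: "real \<Rightarrow> real"
  using Oh_add[OF Oh_mono[of k "\<lambda>h. g h - 1" 0] Oh_const[of 1]] by simp

text \<open>The defect is h (g - 1) v + (h^2 / 2) (g f - 1) w + h g r, where g f - 1 = g (f - 1) +
  (g - 1). Each of the three terms is O(h^3).\<close>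

lemma two_stage_defect_small:
  fixes v w :: "'a::euclidean_space"
  assumes r: "Oh 2 r" and f: "Oh 1 (\<lambda>h. f h - 1)" and g: "Oh 2 (\<lambda>h. g h - 1)"
  shows "Oh 3 (\<lambda>h. (g h * h) *\<^sub>R (v + (f h * h / 2) *\<^sub>R w + r h) - h *\<^sub>R v - (h\<^sup>2 / 2) *\<^sub>R w)"
proof -
  have g0: "Oh 0 g"
    using g by (rule factor_bounded)
  have "Oh (1 + (2 + 0)) (\<lambda>h. h *\<^sub>R (g h - 1) *\<^sub>R v)"
    by (intro Oh_scaleR Oh_ident g Oh_const)
  moreover have "Oh (2 + (1 + 0)) (\<lambda>h. h\<^sup>2 *\<^sub>R (g h * (f h - 1) + (g h - 1)) *\<^sub>R (1 / 2) *\<^sub>R w)"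
    using Oh_mult[OF g0 f] Oh_mono[OF g, of 1]
    by (intro Oh_scaleR Oh_power Oh_const Oh_add) auto
  moreover have "Oh (1 + (0 + 2)) (\<lambda>h. h *\<^sub>R g h *\<^sub>R r h)"
    by (intro Oh_scaleR Oh_ident g0 r)
  ultimately have "Oh 3 (\<lambda>h. h *\<^sub>R (g h - 1) *\<^sub>R v
      + h\<^sup>2 *\<^sub>R (g h * (f h - 1) + (g h - 1)) *\<^sub>R (1 / 2) *\<^sub>R w + h *\<^sub>R g h *\<^sub>R r h)"
    by (intro Oh_add) (simp_all add: eval_nat_numeral)
  also have "(\<lambda>h. h *\<^sub>R (g h - 1) *\<^sub>R v
      + h\<^sup>2 *\<^sub>R (g h * (f h - 1) + (g h - 1)) *\<^sub>R (1 / 2) *\<^sub>R w + h *\<^sub>R g h *\<^sub>R r h)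
    = (\<lambda>h. (g h * h) *\<^sub>R (v + (f h * h / 2) *\<^sub>R w + r h) - h *\<^sub>R v - (h\<^sup>2 / 2) *\<^sub>R w)"
    by (simp add: fun_eq_iff algebra_simps power2_eq_square diff_divide_distrib)
  finally show ?thesis .
qed

text \<open>The order of the conclusions matters: the leading term first bounds \<open>g\<close>,
  then \<open>g h *\<^sub>R r h\<close> can be discarded, and only then is the rest a combination of
  \<open>v\<close> and \<open>w\<close> whose coefficients separate.\<close>

lemma two_stage_factors:
  fixes v w :: "'a::euclidean_space"
  assumes vw: "v \<noteq> w" "independent {v, w}" and f: "Oh 0 f" and r: "Oh 2 r"
    and defect: "Oh 3 (\<lambda>h. (g h * h) *\<^sub>R (v + (f h * h / 2) *\<^sub>R w + r h)
      - h *\<^sub>R v - (h\<^sup>2 / 2) *\<^sub>R w)"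
  shows "Oh 1 (\<lambda>h. f h - 1)" "Oh 2 (\<lambda>h. g h - 1)"
proof -
  let ?e = "\<lambda>h. (f h * h / 2) *\<^sub>R w + r h"
  have "v \<noteq> 0"
    using vw(2) dependent_zero by auto
  have "Oh (Suc 2) (\<lambda>h. h *\<^sub>R (g h *\<^sub>R (v + ?e h) - v - (h / 2) *\<^sub>R w))"
    using defect by (simp add: algebra_simps power2_eq_square eval_nat_numeral)
  then have d2: "Oh 2 (\<lambda>h. g h *\<^sub>R (v + ?e h) - v - (h / 2) *\<^sub>R w)"
    by (rule Oh_cancel)
  have hw: "Oh 1 (\<lambda>h. (h / 2) *\<^sub>R w)"
    using Oh_scaleR[OF Oh_ident Oh_const, of "(1 / 2) *\<^sub>R w"] by simp
  \<comment> \<open>Boundedness of \<open>f\<close> makes the perturbation \<open>?e\<close> of the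
    leading vector O(h).\<close>
  have "Oh (0 + (1 + 0)) (\<lambda>h. f h *\<^sub>R h *\<^sub>R (1 / 2) *\<^sub>R w)"
    by (intro Oh_scaleR f Oh_ident Oh_const)
  then have e: "Oh 1 ?e"
    using Oh_mono[OF r, of 1] by (intro Oh_add) simp_all
  have "Oh 1 (\<lambda>h. g h *\<^sub>R (v + ?e h) - v)"
    using Oh_add[OF Oh_mono[OF d2, of 1] hw] by simp
  then have g1: "Oh 1 (\<lambda>h. g h - 1)"
    by (rule factor_from_leading_term[OF \<open>v \<noteq> 0\<close> e])
  have "Oh 2 (\<lambda>h. g h *\<^sub>R r h)"
    using Oh_scaleR[OF factor_bounded[OF g1] r] by (simp only: add_0)
  with d2 have "Oh 2 (\<lambda>h. g h *\<^sub>R (v + ?e h) - v - (h / 2) *\<^sub>R w - g h *\<^sub>R r h)"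
    by (rule Oh_diff)
  also have "(\<lambda>h. g h *\<^sub>R (v + ?e h) - v - (h / 2) *\<^sub>R w - g h *\<^sub>R r h)
      = (\<lambda>h. (g h - 1) *\<^sub>R v + (h * ((g h * f h - 1) / 2)) *\<^sub>R w)"
    by (simp add: fun_eq_iff algebra_simps diff_divide_distrib)
  finally have "Oh 2 (\<lambda>h. (g h - 1) *\<^sub>R v + (h * ((g h * f h - 1) / 2)) *\<^sub>R w)" .
  note coeffs = Oh_independent_coefficients[OF vw this]
  then show "Oh 2 (\<lambda>h. g h - 1)" by simp
  have "Oh 1 (\<lambda>h. (g h * f h - 1) / 2)"
    using coeffs(2) by - (rule Oh_cancel, simp add: numeral_2_eq_2)
  then have "Oh 1 (\<lambda>h. g h * f h - 1)"
    using Oh_scaleR_const[of 1 "\<lambda>h. (g h * f h - 1) / 2" 2] by (simp add: diff_divide_distrib)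
  \<comment> \<open>The product condition g f = 1 + O(h) yields the one on \<open>f\<close> through
    f - 1 = (g f - 1) - (g - 1) f.\<close>
  moreover have "Oh 1 (\<lambda>h. (g h - 1) * f h)"
    using Oh_mult[OF g1 f] by simp
  ultimately have "Oh 1 (\<lambda>h. (g h * f h - 1) - (g h - 1) * f h)"
    by (rule Oh_diff)
  then show "Oh 1 (\<lambda>h. f h - 1)"
    by (simp add: algebra_simps)
qed

section \<open>Order conditions of the underlying scheme\<close>

lemma method_step_2_iff:
  "method_step 2 A b \<phi> \<phi>new F y0 h Y \<longleftrightarrow> length Y = 4 \<and> Y ! 0 = y0 \<and> Y ! 1 = y0 \<and>
    Y ! 2 = y0 + (\<phi> 2 F Y h * h) *\<^sub>R A 2 1 *\<^sub>R F (Y ! 1) \<and>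
    Y ! 3 = y0 + (\<phi>new F Y h * h) *\<^sub>R (b 1 *\<^sub>R F (Y ! 1) + b 2 *\<^sub>R F (Y ! 2))"
proof -
  have ivl: "{1..2::nat} = {1, 2}" "{1..<2::nat} = {1}" "{1..<1::nat} = {}"
    by auto
  show ?thesis
    by (simp del: One_nat_def add: method_step_def ivl)
qed

text \<open>This covers the two test problems, the constant map and the identity: differences of
  \<open>F\<close> are values of its linear part, whose bound is a Lipschitz constant.\<close>

lemma regular_problem_linear:
  fixes F :: "'a::euclidean_space \<Rightarrow> 'a"
  assumes "C_diff (Suc p) F" "bounded_linear (\<lambda>x. F x - F 0)"
  shows "regular_problem p F y0"
proof -
  obtain L where "\<And>x. norm (F x - F 0) \<le> norm x * L"
    using bounded_linear.bounded[OF assms(2)] by blast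
  then have "norm (F x - F y) \<le> \<bar>L\<bar> * norm (x - y)" for x y
    using bounded_linear.linear[OF assms(2), THEN linear_diff, of x y]
    by (smt (verit) diff_add_cancel diff_diff_eq2 mult.commute mult_right_mono norm_ge_zero)
  then have "\<bar>L\<bar>-lipschitz_on UNIV F"
    by (intro lipschitz_onI) (auto simp: dist_norm)
  then show ?thesis
    using assms(1) by (auto simp: regular_problem_def simp del: C_diff.simps)
qed

lemma rk_local_error:
  fixes F :: "'a::euclidean_space \<Rightarrow> 'a"
  assumes "explicit_rk_order TYPE('a) s A b p" "regular_problem p F (y 0)"
    and "solution_from F 0 y"
    and "\<And>h. method_step s A b (\<lambda>_ _ _ _. 1) (\<lambda>_ _ _. 1) F (y 0) h (Y h)"
  shows "Oh (p + 1) (\<lambda>h. Y h ! (s + 1) - y h)"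
proof -
  have "(\<lambda>h. norm (Y h ! (s + 1) - y (0 + h))) \<in> O[at_right 0](\<lambda>h. h ^ (p + 1))"
    using assms unfolding explicit_rk_order_def method_order_def for_all_steps_def
    by (blast intro: always_eventually)
  then show ?thesis
    by (simp only: bigo_iff_Oh Oh_norm_iff add_0)
qed

text \<open>For the constant field \<open>c\<close> the step from 0 gives exactly \<open>h\<close>
  times the sum of the weights times \<open>c\<close>, while the solution is
  \<open>h *\<^sub>R c\<close>. An O(h^2) difference forces the sum to be 1.\<close>

lemma rk_order_1_condition:
  assumes rk: "explicit_rk_order TYPE('a::euclidean_space) s A b p" and "p \<ge> 1"
  shows "(\<Sum>j = 1..s. b j) = 1"
proof -
  obtain c :: 'a where "c \<in> Basis"
    using nonempty_Basis by blast
  then have "c \<noteq> 0" by auto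
  \<comment> \<open>At index 0 the sum over \<open>{1..<i}\<close> is empty, so the list starts with
    the initial value 0.\<close>
  define Y where "Y h = map (\<lambda>i. if i = s + 1 then (h * (\<Sum>j = 1..s. b j)) *\<^sub>R c
      else (h * (\<Sum>j = 1..<i. A i j)) *\<^sub>R c) [0..<s + 2]" for h
  have Y: "Y h ! i = (if i = s + 1 then (h * (\<Sum>j = 1..s. b j)) *\<^sub>R c
      else (h * (\<Sum>j = 1..<i. A i j)) *\<^sub>R c)" if "i < s + 2" for h i
    using that unfolding Y_def by (subst nth_map) (simp_all del: upt_Suc)
  have "Oh (p + 1) (\<lambda>h. Y h ! (s + 1) - h *\<^sub>R c)"
  proof (rule rk_local_error[OF rk])
    \<comment> \<open>The initial value 0 is written as the solution
      \<open>\<lambda>t. t *\<^sub>R c\<close> evaluated at time 0.\<close>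
    show "regular_problem p (\<lambda>_. c) (0 *\<^sub>R c)"
      by (rule regular_problem_linear) (simp_all only: C_diff_const diff_self bounded_linear_zero)
    show "solution_from (\<lambda>_. c) 0 (\<lambda>t. t *\<^sub>R c)"
      unfolding solution_from_def
      by (intro exI[of _ 1]) (auto intro!: derivative_eq_intros)
    show "method_step s A b (\<lambda>_ _ _ _. 1) (\<lambda>_ _ _. 1) (\<lambda>_. c) (0 *\<^sub>R c) h (Y h)" for h
      by (simp add: method_step_def Y flip: scaleR_sum_left)
        (simp add: Y_def)
  qed
  then have "Oh (Suc (Suc 0)) (\<lambda>h. Y h ! (s + 1) - h *\<^sub>R c)"
    by (rule Oh_mono) (use \<open>p \<ge> 1\<close> in simp)
  then have "Oh (Suc (Suc 0)) (\<lambda>h. h *\<^sub>R ((\<Sum>j = 1..s. b j) - 1) *\<^sub>R c)"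
    by (simp add: Y algebra_simps)
  from Oh_const_imp_0[OF Oh_cancel[OF this]] \<open>c \<noteq> 0\<close> show ?thesis
    by simp
qed

text \<open>For the identity as right-hand side the step multiplies \<open>c\<close> by 1 + h + h^2
  b_2 a_21, to be compared with the exponential up to the quadratic term.\<close>

lemma rk_order_2_condition:
  assumes rk: "explicit_rk_order TYPE('a::euclidean_space) 2 A b 2"
  shows "b 2 * A 2 1 = 1 / 2"
proof -
  have sum_b: "b 1 + b 2 = 1"
    using rk_order_1_condition[OF rk] by (simp add: numeral_2_eq_2)
  obtain c :: 'a where "c \<in> Basis"
    using nonempty_Basis by blast
  then have "c \<noteq> 0" by auto
  define y where "y t = exp t *\<^sub>R c" for t
  have y0: "y 0 = c"
    by (simp add: y_def)
  define Y where "Y h = [c, c, (1 + h * A 2 1) *\<^sub>R c,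
      (1 + h * (b 1 + b 2 * (1 + h * A 2 1))) *\<^sub>R c]" for h
  have reg: "regular_problem 2 (\<lambda>x. x) (y 0)"
    by (rule regular_problem_linear) (simp_all only: C_diff_ident diff_zero bounded_linear_ident)
  have sol: "solution_from (\<lambda>x. x) 0 y"
    unfolding solution_from_def y_def
    by (intro exI[of _ 1]) (auto intro!: derivative_eq_intros)
  have "method_step 2 A b (\<lambda>_ _ _ _. 1) (\<lambda>_ _ _. 1) (\<lambda>x. x) (y 0) h (Y h)" for h
    by (simp add: method_step_2_iff Y_def y0 algebra_simps)
  from rk_local_error[OF rk reg sol this]
  have err: "Oh 3 (\<lambda>h. Y h ! 3 - y h)"
    by simp
  obtain L where "L-lipschitz_on UNIV (\<lambda>x::'a. x)"
    using reg by (auto simp: regular_problem_def)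
  \<comment> \<open>The Taylor expansion of the exponential is an instance of the general expansion
    of solutions, as both elementary differentials at \<open>c\<close> are \<open>c\<close>
    itself.\<close>
  then have "Oh 3 (\<lambda>h. y h - c - h *\<^sub>R c - (h\<^sup>2 / 2) *\<^sub>R c)"
    using solution_expansion_2[OF _ C_diff_ident sol] by (simp add: y0)
  with err have "Oh 3 (\<lambda>h. (Y h ! 3 - y h) + (y h - c - h *\<^sub>R c - (h\<^sup>2 / 2) *\<^sub>R c))"
    by (rule Oh_add)
  also have "(\<lambda>h. (Y h ! 3 - y h) + (y h - c - h *\<^sub>R c - (h\<^sup>2 / 2) *\<^sub>R c))
      = (\<lambda>h. h *\<^sub>R h *\<^sub>R (b 2 * A 2 1 - 1 / 2) *\<^sub>R c)"
  proof
    fix h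
    \<comment> \<open>Eliminating \<open>b 1\<close> makes the terms linear in \<open>h\<close>
      cancel.\<close>
    have b1: "b 1 = 1 - b 2" using sum_b by simp
    show "(Y h ! 3 - y h) + (y h - c - h *\<^sub>R c - (h\<^sup>2 / 2) *\<^sub>R c)
      = h *\<^sub>R h *\<^sub>R (b 2 * A 2 1 - 1 / 2) *\<^sub>R c"
      by (simp del: One_nat_def add: b1 Y_def y_def algebra_simps power2_eq_square diff_divide_distrib)
  qed
  finally have "Oh (Suc (Suc (Suc 0))) (\<lambda>h. h *\<^sub>R h *\<^sub>R (b 2 * A 2 1 - 1 / 2) *\<^sub>R c)"
    by (simp only: numeral_3_eq_3)
  from Oh_const_imp_0[OF Oh_cancel[OF Oh_cancel[OF this]]] \<open>c \<noteq> 0\<close> show ?thesis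
    by simp
qed

section \<open>Expansion of one step\<close>

text \<open>All solutions from \<open>y0\<close> agree with \<open>q\<close> up to O(h^k), so
  \<open>q\<close> can replace them. From left to right some solution must exist, as otherwise the
  left side would hold vacuously.\<close>

lemma local_error_iff:
  fixes F :: "'a::euclidean_space \<Rightarrow> 'a"
  assumes L: "L-lipschitz_on UNIV F"
    and q: "\<And>t0 y. solution_from F t0 y \<Longrightarrow> y t0 = y0 \<Longrightarrow> Oh k (\<lambda>h. y (t0 + h) - q h)"
  shows "(\<forall>t0 y. solution_from F t0 y \<and> y t0 = y0 \<longrightarrow>
      (\<lambda>h. norm (x h - y (t0 + h))) \<in> O[at_right 0](\<lambda>h. h ^ k)) \<longleftrightarrow> Oh k (\<lambda>h. x h - q h)"
proof -
  have "Oh k (\<lambda>h. x h - y (t0 + h)) \<longleftrightarrow> Oh k (\<lambda>h. x h - q h)"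
    if "solution_from F t0 y" "y t0 = y0" for t0 y
    using Oh_add[of k "\<lambda>h. x h - y (t0 + h)", OF _ q[OF that]]
      Oh_diff[of k "\<lambda>h. x h - q h", OF _ q[OF that]] by auto
  moreover obtain y where "solution_from F 0 y" "y 0 = y0"
    using L by (rule lipschitz_solution_exists)
  ultimately show ?thesis
    unfolding bigo_iff_Oh Oh_norm_iff by blast
qed

text \<open>Explicitness permits strong induction on the stage: if the earlier stages are O(h)-close
  to \<open>y0\<close>, then \<open>F\<close> is bounded on them, and a bounded factor times
  \<open>h\<close> makes the next increment O(h).\<close>

lemma stage_close_to_initial_value:
  assumes L: "L-lipschitz_on UNIV F"
    and step: "\<forall>\<^sub>F h in at_right 0. method_step s A b \<phi> \<phi>new F y0 h (Y h)"
    and \<phi>: "\<And>i. i \<in> {2..s} \<Longrightarrow> Oh 0 (\<lambda>h. \<phi> i F (Y h) h)"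
  shows "i \<in> {1..s} \<Longrightarrow> Oh 1 (\<lambda>h. Y h ! i - y0)"
proof (induction i rule: less_induct)
  case (less i)
  have eq: "\<forall>\<^sub>F h in at_right 0. (\<phi> i F (Y h) h * h) *\<^sub>R (\<Sum>j = 1..<i. A i j *\<^sub>R F (Y h ! j))
      = Y h ! i - y0"
    using step by eventually_elim (use less.prems in \<open>auto simp: method_step_def\<close>)
  have "Oh 1 (\<lambda>h. (\<phi> i F (Y h) h * h) *\<^sub>R (\<Sum>j = 1..<i. A i j *\<^sub>R F (Y h ! j)))"
  \<comment> \<open>The first stage has an empty sum, which is why factor bounds from index 2 on
    suffice.\<close>
  proof (cases "i = 1")
    case False
    have "Oh 0 (\<lambda>h. F (Y h ! j))" if "j \<in> {1..<i}" for j
    proof -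
      have "Oh 0 (\<lambda>h. F (Y h ! j) - F y0)"
        using that less.prems by (intro Oh_lipschitz[OF L] Oh_mono[OF less.IH]) auto
      from Oh_add[OF this Oh_const[of "F y0"]] show ?thesis by simp
    qed
    then have "Oh ((0 + 1) + 0)
        (\<lambda>h. (\<phi> i F (Y h) h * h) *\<^sub>R (\<Sum>j = 1..<i. A i j *\<^sub>R F (Y h ! j)))"
      using False less.prems
      by (intro Oh_scaleR Oh_mult \<phi> Oh_ident Oh_sum Oh_scaleR_const) auto
    then show ?thesis by simp
  qed (simp add: Oh_0)
  then show ?case
    by (rule Oh_cong[OF eq, THEN iffD1])
qed

text \<open>Since the weights sum to 1, \<open>F y0\<close> can be split off from the weighted sum;
  what remains are differences of \<open>F\<close> at stages O(h)-close to
  \<open>y0\<close>.\<close>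

lemma step_expansion_1:
  assumes L: "L-lipschitz_on UNIV F"
    and step: "\<forall>\<^sub>F h in at_right 0. method_step s A b \<phi> \<phi>new F y0 h (Y h)"
    and \<phi>: "\<And>i. i \<in> {2..s} \<Longrightarrow> Oh 0 (\<lambda>h. \<phi> i F (Y h) h)"
    and sum_b: "(\<Sum>j = 1..s. b j) = 1"
  obtains e where "Oh 1 e" "\<forall>\<^sub>F h in at_right 0.
    Y h ! (s + 1) = y0 + (\<phi>new F (Y h) h * h) *\<^sub>R (F y0 + e h)"
proof
  let ?e = "\<lambda>h. \<Sum>j = 1..s. b j *\<^sub>R (F (Y h ! j) - F y0)"
  show "Oh 1 ?e"
    by (intro Oh_sum Oh_scaleR_const Oh_lipschitz[OF L]
        stage_close_to_initial_value[OF L step \<phi>])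
  have weighted: "(\<Sum>j = 1..s. b j *\<^sub>R F (Y h ! j)) = F y0 + ?e h" for h
    using sum_b by (simp add: scaleR_diff_right sum_subtractf flip: scaleR_sum_left)
  show "\<forall>\<^sub>F h in at_right 0. Y h ! (s + 1) = y0 + (\<phi>new F (Y h) h * h) *\<^sub>R (F y0 + ?e h)"
    using step by eventually_elim (simp only: method_step_def weighted)
qed

text \<open>The first stage is exactly \<open>y0\<close>, so only \<open>F\<close> at the second one
  is expanded. \<open>r\<close> is its Taylor remainder weighted by \<open>b 2\<close>.\<close>

lemma step_expansion_2:
  fixes F :: "'a::euclidean_space \<Rightarrow> 'a"
  assumes L: "L-lipschitz_on UNIV F" and C: "C_diff (Suc (Suc k)) F"
    and step: "\<forall>\<^sub>F h in at_right 0. method_step 2 A b \<phi> \<phi>new F y0 h (Y h)"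
    and \<phi>: "Oh 0 (\<lambda>h. \<phi> 2 F (Y h) h)"
    and b: "b 1 + b 2 = 1" "b 2 * A 2 1 = 1 / 2"
  obtains r where "Oh 2 r" "\<forall>\<^sub>F h in at_right 0.
    Y h ! 3 = y0 + (\<phi>new F (Y h) h * h) *\<^sub>R (F y0
      + (\<phi> 2 F (Y h) h * h / 2) *\<^sub>R frechet_derivative F (at y0) (F y0) + r h)"
proof
  let ?D = "frechet_derivative F (at y0)"
  let ?r = "\<lambda>h. b 2 *\<^sub>R (F (Y h ! 2) - F y0 - ?D (Y h ! 2 - y0))"
  have "Oh 1 (\<lambda>h. Y h ! 2 - y0)"
    using stage_close_to_initial_value[OF L step, of 2] \<phi> by force
  then show "Oh 2 ?r"
    by (intro Oh_scaleR_const Oh_quadratic_remainder[OF C])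
  have lin: "linear ?D"
    using frechet_derivative_bounded_linear[OF C] by (rule bounded_linear.linear)
  show "\<forall>\<^sub>F h in at_right 0. Y h ! 3 = y0 + (\<phi>new F (Y h) h * h) *\<^sub>R (F y0
      + (\<phi> 2 F (Y h) h * h / 2) *\<^sub>R ?D (F y0) + ?r h)"
    using step
  proof eventually_elim
    case (elim h)
    then have Y: "Y h ! 1 = y0" "Y h ! 2 - y0 = (\<phi> 2 F (Y h) h * h * A 2 1) *\<^sub>R F y0"
      "Y h ! 3 = y0 + (\<phi>new F (Y h) h * h) *\<^sub>R (b 1 *\<^sub>R F (Y h ! 1) + b 2 *\<^sub>R F (Y h ! 2))"
      by (simp_all add: method_step_2_iff)
    \<comment> \<open>The displacement of the second stage is a multiple of \<open>F y0\<close>; the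
      weight 1/2 comes from the second order condition.\<close>
    have "b 2 *\<^sub>R ?D (Y h ! 2 - y0) = (\<phi> 2 F (Y h) h * h * (b 2 * A 2 1)) *\<^sub>R ?D (F y0)"
      unfolding Y(2) by (simp add: linear_scale[OF lin] mult_ac)
    also have "\<dots> = (\<phi> 2 F (Y h) h * h / 2) *\<^sub>R ?D (F y0)"
      unfolding b(2) by simp
    finally have "b 1 *\<^sub>R F (Y h ! 1) + b 2 *\<^sub>R F (Y h ! 2)
        = (b 1 + b 2) *\<^sub>R F y0 + (\<phi> 2 F (Y h) h * h / 2) *\<^sub>R ?D (F y0) + ?r h"
      by (simp del: One_nat_def add: Y(1) algebra_simps)
    with Y(3) b(1) show ?case by simp
  qed
qed

section \<open>Order of the modified method\<close>

lemma regular_problem_imp: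
  assumes "regular_problem p F y0"
  obtains L where "L-lipschitz_on UNIV F" "C_diff (Suc p) F"
  using assms by (auto simp: regular_problem_def simp del: C_diff.simps)

lemma generic_problem_1_iff: "generic_problem 1 F y0 \<longleftrightarrow> regular_problem 1 F y0 \<and> F y0 \<noteq> 0"
  by (simp add: generic_problem_def elementary_differentials_def)

lemma generic_problem_2_iff: "generic_problem 2 F y0 \<longleftrightarrow> regular_problem 2 F y0 \<and>
    F y0 \<noteq> frechet_derivative F (at y0) (F y0) \<and>
    independent {F y0, frechet_derivative F (at y0) (F y0)}"
  by (simp add: generic_problem_def elementary_differentials_def)

lemma for_all_steps_mono:
  assumes "for_all_steps \<C> s A b \<phi> \<phi>new Q"
    and "\<And>F y0 Y. \<C> F y0 \<Longrightarrow>
      \<forall>\<^sub>F h in at_right 0. method_step s A b \<phi> \<phi>new F y0 h (Y h) \<Longrightarrow> Q F y0 Y \<Longrightarrow> Q' F y0 Y"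
  shows "for_all_steps \<C> s A b \<phi> \<phi>new Q'"
  using assms unfolding for_all_steps_def by simp

lemma for_all_steps_conj:
  "for_all_steps \<C> s A b \<phi> \<phi>new (\<lambda>F y0 Y. Q F y0 Y \<and> Q' F y0 Y) \<longleftrightarrow>
    for_all_steps \<C> s A b \<phi> \<phi>new Q \<and> for_all_steps \<C> s A b \<phi> \<phi>new Q'"
  unfolding for_all_steps_def by auto

theorem theorem10:
  fixes s p :: nat
    and A :: "nat \<Rightarrow> nat \<Rightarrow> real" and b :: "nat \<Rightarrow> real"
    and \<phi> :: "nat \<Rightarrow> 'a::euclidean_space factor" and \<phi>new :: "'a factor"
  assumes rk: "explicit_rk_order TYPE('a) s A b p"
    and bounded: "\<forall>i\<in>{2..s}. for_all_steps (regular_problem p) s A b \<phi> \<phi>new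
          (\<lambda>F y0 Y. (\<lambda>h. \<phi> i F (Y h) h) \<in> O[at_right 0](\<lambda>h. 1))"
  shows "(p = 1 \<longrightarrow>
            (method_order (generic_problem p) s A b \<phi> \<phi>new 1 \<longleftrightarrow>
               factor_one_plus_O (generic_problem p) s A b \<phi> \<phi>new \<phi>new 1) \<and>
            (factor_one_plus_O (regular_problem p) s A b \<phi> \<phi>new \<phi>new 1 \<longrightarrow>
               method_order (regular_problem p) s A b \<phi> \<phi>new 1)) \<and>
         (p = 2 \<and> s = 2 \<longrightarrow>
            (method_order (generic_problem p) s A b \<phi> \<phi>new 2 \<longleftrightarrow>
               factor_one_plus_O (generic_problem p) s A b \<phi> \<phi>new (\<phi> 2) 1 \<and>
               factor_one_plus_O (generic_problem p) s A b \<phi> \<phi>new \<phi>new 2) \<and>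
            (factor_one_plus_O (regular_problem p) s A b \<phi> \<phi>new (\<phi> 2) 1 \<and>
             factor_one_plus_O (regular_problem p) s A b \<phi> \<phi>new \<phi>new 2 \<longrightarrow>
               method_order (regular_problem p) s A b \<phi> \<phi>new 2))"
proof -
  have \<phi>: "Oh 0 (\<lambda>h. \<phi> i F (Y h) h)"
    if "regular_problem p F y0" "i \<in> {2..s}"
      "\<forall>\<^sub>F h in at_right 0. method_step s A b \<phi> \<phi>new F y0 h (Y h)" for i F y0 Y
    using bounded that unfolding for_all_steps_def bigo_iff_Oh[symmetric] power_0 by blast
  \<comment> \<open>These abbreviations, with exponents kept as \<open>1 + 1\<close> and
    \<open>2 + 1\<close>, match the unfolded notions of order and of factor literally.\<close>
  let ?small_error = "\<lambda>k F y0 Y. \<forall>t0 y. solution_from F t0 y \<and> y t0 = y0 \<longrightarrow>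
      (\<lambda>h. norm (Y h ! (s + 1) - y (t0 + h))) \<in> O[at_right 0](\<lambda>h. h ^ k)"
  let ?factor_1 = "\<lambda>F y0 Y. (\<lambda>h. \<phi>new F (Y h) h - 1) \<in> O[at_right 0](\<lambda>h. h ^ 1)"
  let ?factors_2 = "\<lambda>F y0 Y. (\<lambda>h. \<phi> 2 F (Y h) h - 1) \<in> O[at_right 0](\<lambda>h. h ^ 1) \<and>
      (\<lambda>h. \<phi>new F (Y h) h - 1) \<in> O[at_right 0](\<lambda>h. h ^ 2)"

  \<comment> \<open>Order one for a single problem\<close>
  have order_1: "(?factor_1 F y0 Y \<longrightarrow> ?small_error (1 + 1) F y0 Y) \<and>
      (F y0 \<noteq> 0 \<longrightarrow> ?small_error (1 + 1) F y0 Y \<longrightarrow> ?factor_1 F y0 Y)"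
    if p: "p = 1" and reg: "regular_problem p F y0"
      and step: "\<forall>\<^sub>F h in at_right 0. method_step s A b \<phi> \<phi>new F y0 h (Y h)" for F y0 Y
  proof -
    let ?g = "\<lambda>h. \<phi>new F (Y h) h"
    obtain L where L: "L-lipschitz_on UNIV F"
      using reg by (rule regular_problem_imp)
    obtain e where e: "Oh 1 e" and
      Y: "\<forall>\<^sub>F h in at_right 0. Y h ! (s + 1) = y0 + (?g h * h) *\<^sub>R (F y0 + e h)"
      using step_expansion_1[OF L step \<phi>[OF reg _ step] rk_order_1_condition[OF rk]] p by auto
    have "?small_error 2 F y0 Y \<longleftrightarrow> Oh 2 (\<lambda>h. Y h ! (s + 1) - (y0 + h *\<^sub>R F y0))"
      by (rule local_error_iff[OF L])
        (use solution_expansion_1(2)[OF L] in \<open>auto simp: diff_diff_eq\<close>)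
    also have "\<dots> \<longleftrightarrow> Oh 2 (\<lambda>h. h *\<^sub>R (?g h *\<^sub>R (F y0 + e h) - F y0))"
      by (rule Oh_cong) (use Y in \<open>eventually_elim, simp add: algebra_simps\<close>)
    finally have iff: "?small_error 2 F y0 Y \<longleftrightarrow> \<dots>" .
    show ?thesis
      unfolding one_add_one iff unfolding bigo_iff_Oh
    proof (intro conjI impI)
      assume g: "Oh 1 (\<lambda>h. ?g h - 1)"
      \<comment> \<open>The defect divided by \<open>h\<close> is (g - 1) F(y0) + g e, with
        \<open>?g\<close> bounded because it is 1 + O(h).\<close>
      have "Oh (1 + 0) (\<lambda>h. (?g h - 1) *\<^sub>R F y0)" "Oh (0 + 1) (\<lambda>h. ?g h *\<^sub>R e h)"
        by (intro Oh_scaleR g Oh_const e factor_bounded[OF g])+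
      then have "Oh 1 (\<lambda>h. (?g h - 1) *\<^sub>R F y0 + ?g h *\<^sub>R e h)"
        by (intro Oh_add) simp_all
      then have "Oh (1 + 1) (\<lambda>h. h *\<^sub>R (?g h *\<^sub>R (F y0 + e h) - F y0))"
        by (intro Oh_scaleR Oh_ident) (simp add: algebra_simps)
      then show "Oh 2 (\<lambda>h. h *\<^sub>R (?g h *\<^sub>R (F y0 + e h) - F y0))"
        by (simp only: one_add_one)
    next
      assume "F y0 \<noteq> 0" "Oh 2 (\<lambda>h. h *\<^sub>R (?g h *\<^sub>R (F y0 + e h) - F y0))"
      then have "Oh (Suc 1) (\<lambda>h. h *\<^sub>R (?g h *\<^sub>R (F y0 + e h) - F y0))"
        by (simp only: Suc_1)
      from factor_from_leading_term[OF \<open>F y0 \<noteq> 0\<close> e Oh_cancel[OF this]]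
      show "Oh 1 (\<lambda>h. ?g h - 1)" .
    qed
  qed

  \<comment> \<open>Order two for a single problem\<close>
  have order_2: "(?factors_2 F y0 Y \<longrightarrow> ?small_error (2 + 1) F y0 Y) \<and>
      (F y0 \<noteq> frechet_derivative F (at y0) (F y0) \<longrightarrow>
        independent {F y0, frechet_derivative F (at y0) (F y0)} \<longrightarrow> ?small_error (2 + 1) F y0 Y \<longrightarrow>
        ?factors_2 F y0 Y)"
    if p: "p = 2" "s = 2" and reg: "regular_problem p F y0"
      and step: "\<forall>\<^sub>F h in at_right 0. method_step s A b \<phi> \<phi>new F y0 h (Y h)" for F y0 Y
  proof -
    let ?v = "F y0" and ?w = "frechet_derivative F (at y0) (F y0)"
    let ?f = "\<lambda>h. \<phi> 2 F (Y h) h" and ?g = "\<lambda>h. \<phi>new F (Y h) h"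
    \<comment> \<open>Regularity for \<open>p = 2\<close> means three derivatives, put here in the
      form the expansions expect.\<close>
    obtain L where L: "L-lipschitz_on UNIV F" and C: "C_diff (Suc (Suc 1)) F"
      using reg p(1) by (auto elim!: regular_problem_imp simp: numeral_2_eq_2 simp del: C_diff.simps)
    have f: "Oh 0 ?f"
      using \<phi>[OF reg _ step] p(2) by simp
    have "b 1 + b 2 = 1"
      using rk_order_1_condition[OF rk] p by (simp add: numeral_2_eq_2)
    with rk_order_2_condition[of A b] rk p obtain r where r: "Oh 2 r" and
      Y: "\<forall>\<^sub>F h in at_right 0. Y h ! 3 = y0 + (?g h * h) *\<^sub>R (?v + (?f h * h / 2) *\<^sub>R ?w + r h)"
      using step_expansion_2[OF L C step[unfolded p(2)] f] by auto
    have two_plus_one: "2 + 1 = (3::nat)" by simp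
    have "?small_error 3 F y0 Y \<longleftrightarrow>
        Oh 3 (\<lambda>h. Y h ! (s + 1) - (y0 + (h *\<^sub>R ?v + (h\<^sup>2 / 2) *\<^sub>R ?w)))"
      by (rule local_error_iff[OF L])
        (use solution_expansion_2[OF L C] in \<open>auto simp: diff_diff_eq add.assoc\<close>)
    also have "\<dots> \<longleftrightarrow> Oh 3 (\<lambda>h. (?g h * h) *\<^sub>R (?v + (?f h * h / 2) *\<^sub>R ?w + r h)
        - h *\<^sub>R ?v - (h\<^sup>2 / 2) *\<^sub>R ?w)"
      by (rule Oh_cong) (use Y in \<open>eventually_elim, simp add: p(2)\<close>)
    finally have iff: "?small_error 3 F y0 Y \<longleftrightarrow> \<dots>" .
    show ?thesis
      unfolding two_plus_one iff unfolding bigo_iff_Oh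
      using two_stage_defect_small[OF r, where f = ?f and g = ?g and v = ?v and w = ?w]
        two_stage_factors[OF _ _ f r, where g = ?g and v = ?v and w = ?w]
      by blast
  qed

  \<comment> \<open>From single problems to problem classes\<close>
  have generic_1: "F y0 \<noteq> 0" if "p = 1" "generic_problem p F y0" for F :: "'a \<Rightarrow> 'a" and y0
    using that by (auto simp only: generic_problem_1_iff)
  have generic_2: "F y0 \<noteq> frechet_derivative F (at y0) (F y0)"
    "independent {F y0, frechet_derivative F (at y0) (F y0)}"
    if "p = 2" "generic_problem p F y0" for F :: "'a \<Rightarrow> 'a" and y0
    using that by (auto simp only: generic_problem_2_iff)
  have regular: "regular_problem p F y0" if "generic_problem p F y0" for F :: "'a \<Rightarrow> 'a" and y0
    using that by (simp add: generic_problem_def)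
  \<comment> \<open>Merging the two factor conditions into one quantified statement reduces every
    claim to a pointwise implication for a fixed problem and family of steps.\<close>
  show ?thesis
    unfolding method_order_def factor_one_plus_O_def for_all_steps_conj[symmetric]
  proof (intro conjI impI iffI)
    assume p: "p = 1"
    assume "for_all_steps (generic_problem p) s A b \<phi> \<phi>new (?small_error (1 + 1))"
    then show "for_all_steps (generic_problem p) s A b \<phi> \<phi>new ?factor_1"
      by (rule for_all_steps_mono)
        (rule order_1[OF p regular, THEN conjunct2, THEN mp, THEN mp],
          (assumption | rule generic_1[OF p])+)
  next
    assume p: "p = 1"
    assume "for_all_steps (generic_problem p) s A b \<phi> \<phi>new ?factor_1"
    then show "for_all_steps (generic_problem p) s A b \<phi> \<phi>new (?small_error (1 + 1))"
      by (rule for_all_steps_mono)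
        (rule order_1[OF p regular, THEN conjunct1, THEN mp], assumption+)
  next
    assume p: "p = 1"
    assume "for_all_steps (regular_problem p) s A b \<phi> \<phi>new ?factor_1"
    then show "for_all_steps (regular_problem p) s A b \<phi> \<phi>new (?small_error (1 + 1))"
      by (rule for_all_steps_mono)
        (rule order_1[OF p, THEN conjunct1, THEN mp],
          assumption+)
  next
    assume "p = 2 \<and> s = 2"
    then have p: "p = 2" "s = 2" by simp_all
    assume "for_all_steps (generic_problem p) s A b \<phi> \<phi>new (?small_error (2 + 1))"
    then show "for_all_steps (generic_problem p) s A b \<phi> \<phi>new ?factors_2"
      by (rule for_all_steps_mono)
        (rule order_2[OF p regular, THEN conjunct2, THEN mp, THEN mp, THEN mp],
          (assumption | rule generic_2[OF p(1)])+)
  next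
    assume "p = 2 \<and> s = 2"
    then have p: "p = 2" "s = 2" by simp_all
    assume "for_all_steps (generic_problem p) s A b \<phi> \<phi>new ?factors_2"
    then show "for_all_steps (generic_problem p) s A b \<phi> \<phi>new (?small_error (2 + 1))"
      by (rule for_all_steps_mono)
        (rule order_2[OF p regular, THEN conjunct1, THEN mp], assumption+)
  next
    assume "p = 2 \<and> s = 2"
    then have p: "p = 2" "s = 2" by simp_all
    assume "for_all_steps (regular_problem p) s A b \<phi> \<phi>new ?factors_2"
    then show "for_all_steps (regular_problem p) s A b \<phi> \<phi>new (?small_error (2 + 1))"
      by (rule for_all_steps_mono)
        (rule order_2[OF p, THEN conjunct1, THEN mp], assumption+)
  qed
qed

end
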